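(* Let $(\mathcal{R},\partial,\int)$ be a commutative integro-differential ring with constants $\mathcal{C}$ and let $L=\partial^n+\sum_{i=0}^{n-1}a_i\cdot\partial^i\in\mathcal{R}\langle\partial,\int,\mathrm{E}\rangle$, $n\ge1$, with $a_0,\dots,a_{n-1}\in\mathcal{R}$. Assume that $z_1,\dots,z_n\in\mathcal{R}$ are such that $Lz_i=0$ for all $i$ and $w:=W(z_1,\dots,z_n)$ has a multiplicative inverse $\frac1w\in\mathcal{R}$. Moreover, assume that there are $c_{i,j}\in\mathcal{C}$ ($i\in\{1,\dots,n\}$, $j\in\{0,\dots,n-1\}$) such that $\mathrm{E}\,\partial^k\sum_{i=1}^nc_{i,j}z_i=\delta_{j,k}$ for all $j,k\in\{0,\dots,n-1\}$. Then, with these $c_{i,j}$ and $$G:=\sum_{k=1}^n(-1)^{n-k}\Bigl(z_k-\sum_{i,j=1}^nz_ic_{i,j-1}\cdot\mathrm{E}\cdot(\partial^{j-1}z_k)\Bigr)\cdot\textstyle\int\cdot\displaystyle\frac{W(z_1,\dots,z_{k-1},z_{k+1},\dots,z_n)}{w},$$ we have $L\cdot G=1$ and $\mathrm{E}\cdot G=0$ in $\mathcal{R}\langle\partial,\int,\mathrm{E}\rangle$.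
   Context: Rings are unital and nonzero, of arbitrary characteristic. A derivation on a ring $\mathcal{R}$ is an additive map $\partial$ with $\partial(fg)=(\partial f)g+f\,\partial g$; $\mathcal{C}=\{f\in\mathcal{R}:\partial f=0\}$ is the ring of constants. An integro-differential ring $(\mathcal{R},\partial,\int)$ is a differential ring together with a $\mathcal{C}$-linear map $\int\colon\mathcal{R}\to\mathcal{R}$ satisfying $\partial\int f=f$ for all $f$. Its induced evaluation is $\mathrm{E}f:=f-\int\partial f\in\mathcal{C}$. The ring of integro-differential operators $\mathcal{R}\langle\partial,\int,\mathrm{E}\rangle$ is the (noncommutative unital) ring extension of $\mathcal{R}$ generated by indeterminates $\partial,\int,\mathrm{E}$ that commute with all elements of $\mathcal{C}$, subject to the identities, for all $f\in\mathcal{R}$: $\partial\cdot f=f\cdot\partial+\partial f$, $\ \partial\cdot\int=1$, $\ \int\cdot\partial=1-\mathrm{E}$, $\ \partial\cdot f\cdot\mathrm{E}=\partial f\cdot\mathrm{E}$, $\ \int\cdot f\cdot\mathrm{E}=\int f\cdot\mathrm{E}$, $\ \mathrm{E}\cdot f\cdot\mathrm{E}=\mathrm{E}f\cdot\mathrm{E}$. Here the dot denotes multiplication of operators, whereas $\partial f,\int f,\mathrm{E}f$ without dot denote elements of $\mathcal{R}$. This ring acts on $\mathcal{R}$ (elements of $\mathcal{R}$ as multiplication operators, $\partial,\int,\mathrm{E}$ as the corresponding maps), and $Lz$ denotes this action. The Wronskian of $f_1,\dots,f_k\in\mathcal{R}$ is $W(f_1,\dots,f_k):=\det\bigl((\partial^{i-1}f_j)_{i,j=1,\dots,k}\bigr)$,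 with the empty Wronskian ($k=0$) equal to $1$. $\delta_{j,k}$ is the Kronecker delta. *)

theory Defs
  imports "Jordan_Normal_Form.Determinant"
begin

class comm_differential_ring = comm_ring_1 +
  fixes der :: "'a \<Rightarrow> 'a"
  assumes der_add: "der (f + g) = der f + der g"
    and der_mult: "der (f * g) = der f * g + f * der g"

definition constants :: "'a::comm_differential_ring set"
  where "constants = {c. der c = 0}"

class comm_integro_differential_ring = comm_differential_ring +
  fixes integ :: "'a \<Rightarrow> 'a"
  assumes integ_add: "integ (f + g) = integ f + integ g"
    and integ_const_mult: "der c = 0 \<Longrightarrow> integ (c * f) = c * integ f"
    and der_integ: "der (integ f) = f"

definition evl :: "'a::comm_integro_differential_ring \<Rightarrow> 'a"
  where "evl f = f - integ (der f)"


definition wronskian :: "'a::comm_differential_ring list \<Rightarrow> 'a"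
  where "wronskian fs =
    det (mat (length fs) (length fs) (\<lambda>(i, j). (der ^^ i) (fs ! j)))"

text \<open>The ring of integro-differential operators is given by generators and relations: formal ring
  expressions in the coefficients and the three indeterminates, modulo the least congruence
  that contains the ring axioms, makes \<open>TCoef\<close> a unital ring homomorphism, and contains the defining
  identities. Zero and one are represented by \<open>TCoef 0\<close> and \<open>TCoef 1\<close>.\<close>

datatype 'a idop_term =
    TCoef 'a | TD | TI | TE
  | TAdd "'a idop_term" "'a idop_term"
  | TNeg "'a idop_term"
  | TMul "'a idop_term" "'a idop_term"

inductive idop_eq ::
  "'a::comm_integro_differential_ring idop_term \<Rightarrow> 'a idop_term \<Rightarrow> bool"
where
  ieq_refl: "idop_eq x x"
| ieq_sym: "idop_eq x y \<Longrightarrow> idop_eq y x"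
| ieq_trans: "idop_eq x y \<Longrightarrow> idop_eq y z \<Longrightarrow> idop_eq x z"
| ieq_cong_add: "idop_eq x x' \<Longrightarrow> idop_eq y y' \<Longrightarrow> idop_eq (TAdd x y) (TAdd x' y')"
| ieq_cong_neg: "idop_eq x x' \<Longrightarrow> idop_eq (TNeg x) (TNeg x')"
| ieq_cong_mul: "idop_eq x x' \<Longrightarrow> idop_eq y y' \<Longrightarrow> idop_eq (TMul x y) (TMul x' y')"
| ieq_add_assoc: "idop_eq (TAdd (TAdd x y) z) (TAdd x (TAdd y z))"
| ieq_add_comm: "idop_eq (TAdd x y) (TAdd y x)"
| ieq_add_zero: "idop_eq (TAdd (TCoef 0) x) x"
| ieq_add_neg: "idop_eq (TAdd (TNeg x) x) (TCoef 0)"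
| ieq_mul_assoc: "idop_eq (TMul (TMul x y) z) (TMul x (TMul y z))"
| ieq_mul_one_left: "idop_eq (TMul (TCoef 1) x) x"
| ieq_mul_one_right: "idop_eq (TMul x (TCoef 1)) x"
| ieq_distrib_right: "idop_eq (TMul (TAdd x y) z) (TAdd (TMul x z) (TMul y z))"
| ieq_distrib_left: "idop_eq (TMul x (TAdd y z)) (TAdd (TMul x y) (TMul x z))"
| ieq_coef_add: "idop_eq (TCoef (f + g)) (TAdd (TCoef f) (TCoef g))"
| ieq_coef_mul: "idop_eq (TCoef (f * g)) (TMul (TCoef f) (TCoef g))"
| ieq_const_D: "c \<in> constants \<Longrightarrow> idop_eq (TMul TD (TCoef c)) (TMul (TCoef c) TD)"
| ieq_const_I: "c \<in> constants \<Longrightarrow> idop_eq (TMul TI (TCoef c)) (TMul (TCoef c) TI)"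
| ieq_const_E: "c \<in> constants \<Longrightarrow> idop_eq (TMul TE (TCoef c)) (TMul (TCoef c) TE)"
| ieq_D_coef: "idop_eq (TMul TD (TCoef f)) (TAdd (TMul (TCoef f) TD) (TCoef (der f)))"
| ieq_D_I: "idop_eq (TMul TD TI) (TCoef 1)"
| ieq_I_D: "idop_eq (TMul TI TD) (TAdd (TCoef 1) (TNeg TE))"
| ieq_D_coef_E: "idop_eq (TMul (TMul TD (TCoef f)) TE) (TMul (TCoef (der f)) TE)"
| ieq_I_coef_E: "idop_eq (TMul (TMul TI (TCoef f)) TE) (TMul (TCoef (integ f)) TE)"
| ieq_E_coef_E: "idop_eq (TMul (TMul TE (TCoef f)) TE) (TMul (TCoef (evl f)) TE)"

quotient_type (overloaded) 'a idop =
  "'a::comm_integro_differential_ring idop_term" / idop_eq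
  by (rule equivpI; (rule reflpI sympI transpI)) (auto intro: idop_eq.intros)

primrec act_term :: "'a::comm_integro_differential_ring idop_term \<Rightarrow> 'a \<Rightarrow> 'a" where
  "act_term (TCoef f) g = f * g"
| "act_term TD g = der g"
| "act_term TI g = integ g"
| "act_term TE g = evl g"
| "act_term (TAdd x y) g = act_term x g + act_term y g"
| "act_term (TNeg x) g = - act_term x g"
| "act_term (TMul x y) g = act_term x (act_term y g)"

lemma der_0 [simp]: "der (0 :: 'a::comm_differential_ring) = 0"
  using der_add[of 0 "0::'a"] by simp

lemma der_minus: "der (- f) = - der (f :: 'a::comm_differential_ring)"
  using der_add[of f "- f"] by (simp add: eq_neg_iff_add_eq_0 add.commute)

lemma der_diff: "der (f - g) = der f - der (g :: 'a::comm_differential_ring)"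
  using der_add[of f "- g"] by (simp add: der_minus)

lemma integ_0 [simp]: "integ (0 :: 'a::comm_integro_differential_ring) = 0"
  using integ_add[of 0 "0::'a"] by simp

lemma integ_minus: "integ (- f) = - integ (f :: 'a::comm_integro_differential_ring)"
  using integ_add[of f "- f"] by (simp add: eq_neg_iff_add_eq_0 add.commute)

lemma evl_0 [simp]: "evl (0 :: 'a::comm_integro_differential_ring) = 0"
  by (simp add: evl_def)

lemma evl_add: "evl (f + g) = evl f + evl (g :: 'a::comm_integro_differential_ring)"
  by (simp add: evl_def der_add integ_add)

lemma evl_minus: "evl (- f) = - evl (f :: 'a::comm_integro_differential_ring)"
  by (simp add: evl_def der_minus integ_minus)

lemma der_evl [simp]: "der (evl (f :: 'a::comm_integro_differential_ring)) = 0"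
  by (simp add: evl_def der_diff der_integ)

lemma evl_const_mult:
  "der c = 0 \<Longrightarrow> evl (c * f) = c * evl (f :: 'a::comm_integro_differential_ring)"
  by (simp add: evl_def der_mult integ_const_mult algebra_simps)

lemma evl_in_constants: "evl f \<in> constants"
  by (simp add: constants_def)

lemma act_term_add: "act_term x (f + g) = act_term x f + act_term x g"
  by (induction x arbitrary: f g)
    (simp_all add: der_add integ_add evl_add algebra_simps)

lemma act_term_cong: "idop_eq x y \<Longrightarrow> act_term x = act_term y"
proof (induction rule: idop_eq.induct)
  case (ieq_D_coef_E f)
  then show ?case by (simp add: fun_eq_iff der_mult)
next
  case (ieq_I_D)
  then show ?case by (simp add: fun_eq_iff evl_def)
next
  case (ieq_I_coef_E f)
  have "integ (f * evl h) = integ f * evl h" for h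
    using integ_const_mult[of "evl h" f] by (simp add: mult.commute)
  then show ?case by (auto simp: fun_eq_iff)
next
  case (ieq_E_coef_E f)
  have "evl (f * evl h) = evl f * evl h" for h
    using evl_const_mult[of "evl h" f] by (simp add: mult.commute)
  then show ?case by (auto simp: fun_eq_iff)
qed (auto simp: fun_eq_iff constants_def der_mult der_integ evl_const_mult integ_const_mult
      act_term_add algebra_simps)

instantiation idop :: (comm_integro_differential_ring) ring_1
begin

lift_definition zero_idop :: "'a idop" is "TCoef 0" .
lift_definition one_idop :: "'a idop" is "TCoef 1" .
lift_definition plus_idop :: "'a idop \<Rightarrow> 'a idop \<Rightarrow> 'a idop" is TAdd by (rule ieq_cong_add)
lift_definition uminus_idop :: "'a idop \<Rightarrow> 'a idop" is TNeg by (rule ieq_cong_neg)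
lift_definition minus_idop :: "'a idop \<Rightarrow> 'a idop \<Rightarrow> 'a idop" is "\<lambda>x y. TAdd x (TNeg y)"
  by (intro ieq_cong_add ieq_cong_neg)
lift_definition times_idop :: "'a idop \<Rightarrow> 'a idop \<Rightarrow> 'a idop" is TMul by (rule ieq_cong_mul)

instance
proof
  fix x y z :: "'a idop"
  show "x + y + z = x + (y + z)" by transfer (rule ieq_add_assoc)
  show "x + y = y + x" by transfer (rule ieq_add_comm)
  show "0 + x = x" by transfer (rule ieq_add_zero)
  show "- x + x = 0" by transfer (rule ieq_add_neg)
  show "x - y = x + - y" by transfer (rule ieq_refl)
  show "x * y * z = x * (y * z)" by transfer (rule ieq_mul_assoc)
  show "1 * x = x" by transfer (rule ieq_mul_one_left)
  show "x * 1 = x" by transfer (rule ieq_mul_one_right)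
  show "(x + y) * z = x * z + y * z" by transfer (rule ieq_distrib_right)
  show "x * (y + z) = x * y + x * z" by transfer (rule ieq_distrib_left)
  have "\<not> idop_eq (TCoef (0::'a)) (TCoef 1)"
  proof
    assume "idop_eq (TCoef (0::'a)) (TCoef 1)"
    then have "act_term (TCoef (0::'a)) 1 = act_term (TCoef 1) 1" by (simp only: act_term_cong)
    then show False by simp
  qed
  then show "(0 :: 'a idop) \<noteq> 1" by transfer
qed

end

lift_definition coef :: "'a::comm_integro_differential_ring \<Rightarrow> 'a idop" is TCoef .
lift_definition opD :: "'a::comm_integro_differential_ring idop" is TD .
lift_definition opI :: "'a::comm_integro_differential_ring idop" is TI .
lift_definition opE :: "'a::comm_integro_differential_ring idop" is TE .

lift_definition act :: "'a::comm_integro_differential_ring idop \<Rightarrow> 'a \<Rightarrow> 'a" is act_term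
  by (rule act_term_cong)

lemma coef_0: "coef 0 = 0" by transfer (rule ieq_refl)
lemma coef_1: "coef 1 = 1" by transfer (rule ieq_refl)
lemma coef_plus: "coef (f + g) = coef f + coef g" by transfer (rule ieq_coef_add)
lemma coef_times: "coef (f * g) = coef f * coef g" by transfer (rule ieq_coef_mul)

lemma opD_coef: "opD * coef f = coef f * opD + coef (der f)" by transfer (rule ieq_D_coef)
lemma opD_opI: "opD * opI = 1" by transfer (rule ieq_D_I)
lemma opI_opD: "opI * opD = 1 - opE" by transfer (rule ieq_I_D)
lemma opD_coef_opE: "opD * coef f * opE = coef (der f) * opE" by transfer (rule ieq_D_coef_E)
lemma opI_coef_opE: "opI * coef f * opE = coef (integ f) * opE" by transfer (rule ieq_I_coef_E)
lemma opE_coef_opE: "opE * coef f * opE = coef (evl f) * opE" by transfer (rule ieq_E_coef_E)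
lemma opI_const: "c \<in> constants \<Longrightarrow> opI * coef c = coef c * opI" by transfer (rule ieq_const_I)
lemma opE_const: "c \<in> constants \<Longrightarrow> opE * coef c = coef c * opE" by transfer (rule ieq_const_E)

lemma act_simps [simp]:
  "act (coef f) g = f * g"
  "act opD g = der g"
  "act opI g = integ g"
  "act opE g = evl g"
  "act 0 g = 0"
  "act 1 g = g"
  "act (A + B) g = act A g + act B g"
  "act (A - B) g = act A g - act B g"
  "act (- A) g = - act A g"
  "act (A * B) g = act A (act B g)"
  by (transfer; simp)+

lemma inj_coef: "inj coef"
  by (rule injI) (metis act_simps(1) mult_1_right)

end

theory Submission
  imports Defs
begin

text \<open>Variation of constants. Let \<open>u\<^sub>k = (-1)\<^bsup>n-k\<^esup> W(z\<^sub>1,\<dots>,z\<^sub>k\<^sub>-\<^sub>1,z\<^sub>k\<^sub>+\<^sub>1,\<dots>,z\<^sub>n) / w\<close> and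
  \<open>S\<^sub>j = \<Sum>\<^sub>k \<partial>\<^sup>jz\<^sub>k \<cdot> \<integral> \<cdot> u\<^sub>k\<close>. Expanding the Wronskian along its last row gives
  \<open>\<Sum>\<^sub>k \<partial>\<^sup>jz\<^sub>k u\<^sub>k = \<delta>\<^bsub>j,n-1\<^esub>\<close>, hence \<open>\<partial> \<cdot> S\<^sub>j = S\<^sub>j\<^sub>+\<^sub>1 + \<delta>\<^bsub>j,n-1\<^esub>\<close> and \<open>L \<cdot> S\<^sub>0 = 1\<close>.
  With \<open>e\<^sub>j = \<Sum>\<^sub>i c\<^sub>i\<^sub>,\<^sub>j z\<^sub>i\<close> one has \<open>G = S\<^sub>0 - \<Sum>\<^sub>j e\<^sub>j \<cdot> E \<cdot> S\<^sub>j\<close>. The correction does not affect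
  \<open>L \<cdot> G\<close>, since \<open>L \<cdot> e\<^sub>j \<cdot> E = (L e\<^sub>j) \<cdot> E = 0\<close>, and it cancels \<open>E \<cdot> S\<^sub>0\<close>, since
  \<open>E \<cdot> e\<^sub>j \<cdot> E = \<delta>\<^bsub>j,0\<^esub> E\<close>.\<close>

lemma der_sum: "der (sum f A) = (\<Sum>x\<in>A. der (f x :: 'a::comm_differential_ring))"
  by (induction A rule: infinite_finite_induct) (simp_all add: der_add)

lemma coef_sum: "coef (sum f A) = (\<Sum>x\<in>A. coef (f x))"
  by (induction A rule: infinite_finite_induct) (simp_all add: coef_0 coef_plus)

lemma coef_minus: "coef (- f) = - coef f"
  using coef_plus[of f "- f"] by (simp add: coef_0 eq_neg_iff_add_eq_0 add.commute)

lemma coef_neg_one_power: "coef ((-1) ^ m) = (-1) ^ m"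
  by (induction m) (simp_all add: coef_1 coef_times coef_minus)

lemma act_sum: "act (sum F A) g = (\<Sum>x\<in>A. act (F x) g)"
  by (induction A rule: infinite_finite_induct) simp_all

lemma act_opD_power: "act (opD ^ m) g = (der ^^ m) g"
  by (induction m) simp_all

lemma opD_power_coef_opE: "opD ^ m * coef f * opE = coef ((der ^^ m) f) * opE"
proof (induction m)
  case (Suc m)
  have "opD ^ Suc m * coef f * opE = opD * (opD ^ m * coef f * opE)"
    by (simp add: mult.assoc)
  also have "\<dots> = opD * coef ((der ^^ m) f) * opE"
    by (subst Suc.IH) (simp only: mult.assoc)
  finally show ?case by (simp add: opD_coef_opE)
qed simp

text \<open>Since \<open>opD * opE\<close> vanishes, a differential operator to the left of
  \<open>coef f * opE\<close> only differentiates \<open>f\<close>. Hence the product is zero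
  whenever \<open>f\<close> solves \<open>act L f = 0\<close>.\<close>

lemma differential_operator_coef_opE:
  fixes a :: "nat \<Rightarrow> 'a::comm_integro_differential_ring"
  assumes "L = opD ^ n + (\<Sum>i<n. coef (a i) * opD ^ i)"
  shows "L * coef f * opE = coef (act L f) * opE"
proof -
  have "L * coef f * opE =
      opD ^ n * coef f * opE + (\<Sum>i<n. coef (a i) * (opD ^ i * coef f * opE))"
    by (simp add: assms distrib_right sum_distrib_right mult.assoc)
  also have "\<dots> = coef (act L f) * opE"
    by (simp add: opD_power_coef_opE[unfolded mult.assoc] assms act_sum act_opD_power
        coef_plus coef_sum coef_times distrib_right sum_distrib_right mult.assoc)
  finally show ?thesis .
qed

lemma der_funpow_const_mult: "der c = 0 \<Longrightarrow> (der ^^ m) (c * f) = c * (der ^^ m) f"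
  by (induction m) (simp_all add: der_mult)

lemma der_funpow_sum:
  "(der ^^ m) (sum f A) = (\<Sum>x\<in>A. (der ^^ m) (f x :: 'a::comm_differential_ring))"
  by (induction m) (simp_all add: der_sum)

text \<open>Constants pass through every power of the derivation. Thus constant combinations of
  solutions are again solutions.\<close>

lemma act_differential_operator_sum:
  fixes a :: "nat \<Rightarrow> 'a::comm_integro_differential_ring"
  assumes "L = opD ^ n + (\<Sum>i<n. coef (a i) * opD ^ i)"
    and "\<And>x. x \<in> A \<Longrightarrow> c x \<in> constants"
  shows "act L (\<Sum>x\<in>A. c x * f x) = (\<Sum>x\<in>A. c x * act L (f x))"
proof -
  have pow: "(der ^^ m) (\<Sum>x\<in>A. c x * f x) = (\<Sum>x\<in>A. c x * (der ^^ m) (f x))" for m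
    unfolding der_funpow_sum
    by (intro sum.cong refl der_funpow_const_mult) (use assms(2) in \<open>auto simp: constants_def\<close>)
  have "(\<Sum>i<n. a i * (\<Sum>x\<in>A. c x * (der ^^ i) (f x))) =
      (\<Sum>x\<in>A. c x * (\<Sum>i<n. a i * (der ^^ i) (f x)))"
    unfolding sum_distrib_left by (subst sum.swap) (simp add: ac_simps)
  then show ?thesis
    by (simp add: assms(1) act_sum act_opD_power pow distrib_left sum.distrib)
qed

text \<open>The signed minors are the cofactors of the last row, so each sum is an entry in the last
  column of matrix times adjugate, that is, of the determinant times the identity.\<close>

lemma wronskian_last_row_expansion:
  fixes fs :: "'a::comm_differential_ring list"
  assumes "i < length fs"
  shows "(\<Sum>k<length fs. (der ^^ i) (fs ! k) *
      ((-1) ^ (length fs - Suc k) * wronskian (take k fs @ drop (Suc k) fs))) =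
    (if Suc i = length fs then wronskian fs else 0)"
proof -
  define n where "n = length fs"
  define A where "A = mat n n (\<lambda>(i, j). (der ^^ i) (fs ! j))"
  have A: "A \<in> carrier_mat n n" by (simp add: A_def)
  have i: "i < n" using assms by (simp add: n_def)
  have cof: "cofactor A (n - 1) k =
      (-1) ^ (n - Suc k) * wronskian (take k fs @ drop (Suc k) fs)" if "k < n" for k
  proof -
    \<comment> \<open>Deleting the last row keeps the first \<open>n - 1\<close> derivative orders,
      so the minor is again a Wronskian.\<close>
    have "mat_delete A (n - 1) k = mat (n - 1) (n - 1)
        (\<lambda>(i, j). (der ^^ i) ((take k fs @ drop (Suc k) fs) ! j))"
      using that by (intro eq_matI)
        (auto simp: mat_delete_def A_def nth_append n_def min_def)
    moreover have "length (take k fs @ drop (Suc k) fs) = n - 1"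
      using that by (simp add: n_def)
    moreover have "(-1 :: 'a) ^ (n - 1 + k) = (-1) ^ (n - Suc k)"
    proof -
      have "n - 1 + k = n - Suc k + 2 * k" using that by simp
      then show ?thesis
        by (simp only: power_add power_mult power2_minus one_power2 power_one mult_1_right)
    qed
    ultimately show ?thesis by (simp add: cofactor_def wronskian_def)
  qed
  have "(\<Sum>k<n. (der ^^ i) (fs ! k) *
      ((-1) ^ (n - Suc k) * wronskian (take k fs @ drop (Suc k) fs))) =
      (\<Sum>k<n. A $$ (i, k) * cofactor A (n - 1) k)"
    using i by (intro sum.cong refl) (simp add: A_def cof[symmetric])
  also have "\<dots> = (A * adj_mat A) $$ (i, n - 1)"
    using i A by (auto simp: adj_mat_def scalar_prod_def atLeast0LessThan intro!: sum.cong)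
  also have "\<dots> = (det A \<cdot>\<^sub>m 1\<^sub>m n) $$ (i, n - 1)"
    using adj_mat(2)[OF A] by simp
  also have "\<dots> = (if Suc i = n then wronskian fs else 0)"
    using i by (auto simp: wronskian_def A_def n_def)
  finally show ?thesis by (simp only: n_def)
qed

text \<open>The powers of \<open>\<partial>\<close> pass through the integrals without producing extra terms until
  the last one; this is Lagrange's condition on the variation of constants.\<close>

lemma opD_power_variation:
  fixes z u :: "nat \<Rightarrow> 'a::comm_integro_differential_ring"
  assumes lagrange: "\<And>i. i < n \<Longrightarrow>
      (\<Sum>k\<in>K. (der ^^ i) (z k) * u k) = (if Suc i = n then 1 else 0)"
    and "m \<le> n"
  shows "opD ^ m * (\<Sum>k\<in>K. coef (z k) * opI * coef (u k)) =
    (\<Sum>k\<in>K. coef ((der ^^ m) (z k)) * opI * coef (u k)) + (if m = n \<and> n > 0 then 1 else 0)"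
  using \<open>m \<le> n\<close>
proof (induction m)
  case (Suc m)
  \<comment> \<open>By the Leibniz rule \<open>opD\<close> either differentiates \<open>f\<close> or
    reaches \<open>opI\<close> and cancels it.\<close>
  have step: "opD * (coef f * opI * coef g) = coef (der f) * opI * coef g + coef (f * g)"
    for f g :: 'a
  proof -
    have "opD * (coef f * opI * coef g) = opD * coef f * opI * coef g"
      by (simp only: mult.assoc)
    also have "\<dots> = coef f * (opD * opI) * coef g + coef (der f) * opI * coef g"
      by (simp only: opD_coef distrib_right mult.assoc)
    finally show ?thesis by (simp add: opD_opI coef_times add.commute)
  qed
  have "opD ^ Suc m * (\<Sum>k\<in>K. coef (z k) * opI * coef (u k)) =
      opD * (\<Sum>k\<in>K. coef ((der ^^ m) (z k)) * opI * coef (u k))"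
    using Suc by (simp add: mult.assoc)
  also have "\<dots> = (\<Sum>k\<in>K. coef ((der ^^ Suc m) (z k)) * opI * coef (u k)) +
      coef (\<Sum>k\<in>K. (der ^^ m) (z k) * u k)"
    by (simp add: sum_distrib_left step sum.distrib coef_sum)
  also have "coef (\<Sum>k\<in>K. (der ^^ m) (z k) * u k) = (if Suc m = n \<and> n > 0 then 1 else 0)"
    using Suc.prems by (simp add: lagrange coef_0 coef_1)
  finally show ?case .
\<comment> \<open>In the base case no derivation is applied; the guard \<open>n > 0\<close> excludes
  a spurious 1 when \<open>m = n = 0\<close>.\<close>
qed auto

text \<open>The 1 comes from the leading power alone; all other terms collect
  \<open>act L (z k)\<close> to the left of the integral.\<close>

lemma variation_of_constants:
  fixes a z u :: "nat \<Rightarrow> 'a::comm_integro_differential_ring"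
  assumes L: "L = opD ^ n + (\<Sum>i<n. coef (a i) * opD ^ i)"
    and "n > 0"
    and lagrange: "\<And>i. i < n \<Longrightarrow>
      (\<Sum>k\<in>K. (der ^^ i) (z k) * u k) = (if Suc i = n then 1 else 0)"
    and sol: "\<And>k. k \<in> K \<Longrightarrow> act L (z k) = 0"
  shows "L * (\<Sum>k\<in>K. coef (z k) * opI * coef (u k)) = 1"
proof -
  define S where "S m = (\<Sum>k\<in>K. coef ((der ^^ m) (z k)) * opI * coef (u k))" for m
  have pow: "opD ^ m * S 0 = S m + (if m = n then 1 else 0)" if "m \<le> n" for m
    using opD_power_variation[where z = z and u = u, OF lagrange that] \<open>n > 0\<close> by (simp add: S_def)
  have "L * S 0 = S n + 1 + (\<Sum>i<n. coef (a i) * S i)"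
    by (simp add: L distrib_right sum_distrib_right mult.assoc pow)
  also have "(\<Sum>i<n. coef (a i) * S i) =
      (\<Sum>k\<in>K. coef (\<Sum>i<n. a i * (der ^^ i) (z k)) * opI * coef (u k))"
    unfolding S_def sum_distrib_left coef_sum sum_distrib_right
    by (subst sum.swap) (simp add: coef_times mult.assoc)
  also have "S n + 1 + \<dots> = 1 + (\<Sum>k\<in>K. coef (act L (z k)) * opI * coef (u k))"
    by (simp add: S_def L act_sum act_opD_power coef_plus distrib_right sum.distrib)
  also have "\<dots> = 1" by (simp add: sol coef_0)
  finally show ?thesis by (simp add: S_def)
qed

theorem theorem6p3:
  fixes a z :: "nat \<Rightarrow> 'a::comm_integro_differential_ring"
    and c :: "nat \<Rightarrow> nat \<Rightarrow> 'a"
    and w w_inv :: 'a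
    and L G :: "'a idop"
    and n :: nat
  assumes "n \<ge> 1"
    and "L = opD ^ n + (\<Sum>i<n. coef (a i) * opD ^ i)"
    and "\<And>i. i \<in> {1..n} \<Longrightarrow> act L (z i) = 0"
    and "w = wronskian (map z [1..<Suc n])"
    and "w * w_inv = 1"
    and "\<And>i j. i \<in> {1..n} \<Longrightarrow> j < n \<Longrightarrow> c i j \<in> constants"
    and "\<And>j k. j < n \<Longrightarrow> k < n \<Longrightarrow>
           evl ((der ^^ k) (\<Sum>i=1..n. c i j * z i)) = (if j = k then 1 else 0)"
    and "G = (\<Sum>k=1..n. (-1) ^ (n - k) *
               (coef (z k) - (\<Sum>i=1..n. \<Sum>j=1..n.
                  coef (z i * c i (j - 1)) * opE * coef ((der ^^ (j - 1)) (z k)))) *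
               opI * coef (wronskian (map z ([1..<k] @ [Suc k..<Suc n])) * w_inv))"
  shows "L * G = 1 \<and> opE * G = 0"
proof -
  \<comment> \<open>Cramer's rule: these \<open>u k\<close> solve the Lagrange system whose
    right-hand side is the last unit vector.\<close>
  define u where "u k = (-1) ^ (n - k) *
    (wronskian (map z ([1..<k] @ [Suc k..<Suc n])) * w_inv)" for k
  define S where "S j = (\<Sum>k=1..n. coef ((der ^^ j) (z k)) * opI * coef (u k))" for j
  define e where "e j = (\<Sum>i=1..n. c i j * z i)" for j
  have lagrange: "(\<Sum>k=1..n. (der ^^ i) (z k) * u k) = (if Suc i = n then 1 else 0)"
    if "i < n" for i
  proof -
    define fs where "fs = map z [1..<Suc n]"
    have w: "w = wronskian fs" by (simp only: assms(4) fs_def)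
    have len: "length fs = n" by (simp add: fs_def)
    \<comment> \<open>Positions in \<open>fs\<close> start at 0, indices of \<open>z\<close> at 1:
      deleting position \<open>k\<close> removes \<open>z (Suc k)\<close>.\<close>
    have del: "take k fs @ drop (Suc k) fs = map z ([1..<Suc k] @ [Suc (Suc k)..<Suc n])"
      if "k < n" for k
      using that by (simp add: fs_def take_map drop_map del: upt_Suc)
    have nth: "fs ! k = z (Suc k)" if "k < n" for k
      using that by (simp add: fs_def del: upt_Suc)
    have "(\<Sum>k=1..n. (der ^^ i) (z k) * u k) =
        (\<Sum>k<n. (der ^^ i) (z (Suc k)) * u (Suc k))"
      by (simp add: sum.atLeast1_atMost_eq)
    also have "\<dots> = (\<Sum>k<n. (der ^^ i) (fs ! k) *
        ((-1) ^ (n - Suc k) * wronskian (take k fs @ drop (Suc k) fs))) * w_inv"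
      unfolding sum_distrib_right
      by (intro sum.cong refl) (simp only: lessThan_iff nth del u_def mult.assoc)
    also have "\<dots> = (if Suc i = n then w * w_inv else 0)"
      using wronskian_last_row_expansion[of i fs] that
      by (simp add: len w)
    finally show ?thesis by (simp add: assms(5))
  qed
  have summand: "(-1) ^ (n - k) *
      (coef (z k) - (\<Sum>i=1..n. \<Sum>j=1..n.
        coef (z i * c i (j - 1)) * opE * coef ((der ^^ (j - 1)) (z k)))) *
      opI * coef (wronskian (map z ([1..<k] @ [Suc k..<Suc n])) * w_inv) =
    coef (z k) * opI * coef (u k) -
      (\<Sum>j<n. coef (e j) * opE * (coef ((der ^^ j) (z k)) * opI * coef (u k)))" for k
  proof -
    \<comment> \<open>Signs commute with every operator, so they can be moved past the integral into
      \<open>u k\<close>.\<close>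
    have central: "(-1) ^ m * X = X * (-1) ^ m" for m and X :: "'a idop"
      by (cases "even m") simp_all
    have inner: "(\<Sum>i=1..n. \<Sum>j=1..n.
        coef (z i * c i (j - 1)) * opE * coef ((der ^^ (j - 1)) (z k))) =
      (\<Sum>j<n. coef (e j) * opE * coef ((der ^^ j) (z k)))"
      by (subst sum.swap)
        (simp add: sum.atLeast1_atMost_eq e_def coef_sum sum_distrib_right mult.commute[of "c _ _"])
    have "coef (u k) = (-1) ^ (n - k) *
        coef (wronskian (map z ([1..<k] @ [Suc k..<Suc n])) * w_inv)"
      unfolding u_def by (simp only: coef_times coef_neg_one_power)
    then have pull: "(-1) ^ (n - k) * X * opI *
        coef (wronskian (map z ([1..<k] @ [Suc k..<Suc n])) * w_inv) = X * opI * coef (u k)"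
      for X
      by (metis central mult.assoc)
    show ?thesis
      unfolding pull inner by (simp only: left_diff_distrib sum_distrib_right mult.assoc)
  qed
  have G: "G = S 0 - (\<Sum>j<n. coef (e j) * opE * S j)"
    unfolding assms(8) summand sum_subtractf
    by (subst sum.swap) (simp add: S_def sum_distrib_left)
  have "act L (e j) = 0" if "j < n" for j
    unfolding e_def using that assms(3,6)
    by (subst act_differential_operator_sum[OF assms(2)]) simp_all
  then have "L * (coef (e j) * opE * S j) = 0" if "j < n" for j
    using that differential_operator_coef_opE[OF assms(2), of "e j"]
    by (simp add: coef_0 flip: mult.assoc)
  then have "L * G = L * S 0"
    by (simp add: G right_diff_distrib sum_distrib_left)
  also have "\<dots> = 1"
    using variation_of_constants[OF assms(2) _ lagrange assms(3)] assms(1) by (simp add: S_def)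
  finally have LG: "L * G = 1" .
  \<comment> \<open>The initial condition of order 0 gives \<open>evl (e j)\<close>. Only the term
    with \<open>j = 0\<close> survives, and it cancels \<open>opE * S 0\<close>.\<close>
  have "opE * (coef (e j) * opE * S j) = (if j = 0 then opE * S 0 else 0)" if "j < n" for j
  proof -
    have "evl (e j) = (if j = 0 then 1 else 0)"
      using assms(7)[of j 0] assms(1) that by (simp add: e_def)
    then show ?thesis
      using opE_coef_opE[of "e j"] by (simp add: coef_0 coef_1 flip: mult.assoc)
  qed
  then have "opE * G = 0"
    using assms(1) by (simp add: G right_diff_distrib sum_distrib_left)
  with LG show ?thesis by simp
qed

end
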